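(* Let $f\in S$ and suppose that $f$ omits two values of equal modulus, i.e. there are $\alpha,\beta\in\mathbb{C}\setminus f(U)$ with $\alpha\neq\beta$ and $|\alpha|=|\beta|$. Let $n\in\mathbb{Z}^+$ be a natural number. Then $f$ has the form $$ f=\sum_{j=1}^{2^n}\alpha_j\cdot f_j, $$ where $0<\alpha_j<1$ for $1\le j\le 2^n$, $\sum_{j=1}^{2^n}\alpha_j=1$, and where $f_1,\dots,f_{2^n}$ are (pairwise) different functions in $S$, each of which omits a non-empty open set (that is, for each $j$ the set $\mathbb{C}\setminus f_j(U)$ contains a non-empty open subset of $\mathbb{C}$).
   Context: $U=\{z\in\mathbb{C}: |z|<1\}$ is the open unit disk and $H(U)$ is the space of holomorphic functions on $U$. $S=\{f\in H(U): f(0)=0,\ f'(0)=1,\ f \text{ is injective on } U\}$. A function $f$ omits a value $\alpha$ if $\alpha\notin f(U)$; it omits a set $E$ if $E\cap f(U)=\emptyset$. *)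

theory Defs
  imports "HOL-Complex_Analysis.Complex_Analysis"
begin

abbreviation unit_disk :: "complex set" where
  "unit_disk \<equiv> ball 0 1"

text \<open>
  Functions on the unit disk are represented by total functions on the complex plane whose
  values outside the disk are irrelevant. Consequently, two of them are different as functions
  on the disk iff they differ at some point of it.
\<close>

definition class_S :: "(complex \<Rightarrow> complex) set" where
  "class_S = {f. f holomorphic_on unit_disk \<and> f 0 = 0 \<and> deriv f 0 = 1 \<and> inj_on f unit_disk}"

definition omits_value :: "(complex \<Rightarrow> complex) \<Rightarrow> complex \<Rightarrow> bool" where
  "omits_value f \<alpha> \<longleftrightarrow> \<alpha> \<notin> f ` unit_disk"

definition omits_set :: "(complex \<Rightarrow> complex) \<Rightarrow> complex set \<Rightarrow> bool" where
  "omits_set f E \<longleftrightarrow> E \<inter> f ` unit_disk = {}"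

end

theory Submission
  imports Defs
begin

text \<open>
  Suppose \<open>f\<close> in \<open>S\<close> omits \<open>\<alpha> \<noteq> \<beta>\<close> with equal moduli. As the disk is simply connected,
  \<open>(f - \<alpha>) (f - \<beta>)\<close> has a holomorphic square root \<open>q\<close>, and \<open>f\<close> is the average of \<open>f + q\<close> and
  \<open>f - q\<close>. Points of the algebraic curve \<open>p\<^sup>2 = (x - \<alpha>) (x - \<beta>)\<close> are determined by the value of
  \<open>x + p\<close> (lemma \<open>curve_point_unique\<close>), so \<open>f + q\<close> and \<open>f - q\<close> are injective with disjoint images,
  and each of them omits the open image of the other. Normalising them at the origin gives two
  functions in \<open>S\<close>; the resulting weights are \<open>(1 + c) / 2\<close> and \<open>(1 - c) / 2\<close> with
  \<open>c = q'(0) = - (\<alpha> + \<beta>) / (2 s)\<close>, where \<open>s = q(0)\<close> satisfies \<open>s\<^sup>2 = \<alpha> \<beta>\<close>. Equality of the moduli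
  is what makes \<open>c\<close> real and \<open>\<bar>c\<bar> < 1\<close> (lemma \<open>slope_real\<close>). This is the case of two summands.

  A function omitting an open set omits many pairs of values of equal modulus, so the splitting can
  be repeated on every summand. What needs care is that all summands stay different. Eliminating
  \<open>q\<close> from \<open>g = (f + q - s) / (1 + c)\<close> gives an algebraic relation between \<open>f\<close> and \<open>g\<close>, and this
  relation determines \<open>s\<close> (lemma \<open>relation_determines_base\<close>), hence the product \<open>\<alpha> \<beta>\<close>. Consequently
  the two halves of one splitting differ, their parameters being \<open>s\<close> and \<open>- s\<close>; and a given function
  can be a half of \<open>f\<close> only for one value of \<open>\<alpha> \<beta>\<close>. Since infinitely many products are available,
  the halves can be chosen to avoid any finite set of functions (lemma \<open>split_avoiding\<close>), which
  is what the step from \<open>2^n\<close> to \<open>2^(n+1)\<close> summands requires.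
\<close>

definition differ_on_disk :: "(complex \<Rightarrow> complex) \<Rightarrow> (complex \<Rightarrow> complex) \<Rightarrow> bool" where
  "differ_on_disk g h \<longleftrightarrow> (\<exists>z\<in>unit_disk. g z \<noteq> h z)"

definition class_S_omitting_open :: "(complex \<Rightarrow> complex) set" where
  "class_S_omitting_open = {g \<in> class_S. \<exists>V. open V \<and> V \<noteq> {} \<and> omits_set g V}"

text \<open>
  The equation obtained by eliminating \<open>q\<close> from \<open>q\<^sup>2 = (f - \<alpha>) (f - \<beta>)\<close> and \<open>\<kappa> g = f + q - s\<close>,
  where \<open>s\<^sup>2 = \<alpha> \<beta>\<close> and \<open>\<alpha> + \<beta> = - 2 s (\<kappa> - 1)\<close>.
\<close>
definition half_relation ::
  "(complex \<Rightarrow> complex) \<Rightarrow> (complex \<Rightarrow> complex) \<Rightarrow> complex \<Rightarrow> complex \<Rightarrow> bool" where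
  "half_relation f g s \<kappa> \<longleftrightarrow>
     (\<forall>z\<in>unit_disk. 2 * (s + g z) * f z = g z * (\<kappa> * g z + 2 * s))"

lemma differ_on_disk_commute: "differ_on_disk g h \<longleftrightarrow> differ_on_disk h g"
  unfolding differ_on_disk_def by metis

lemma half_relation_cong:
  assumes "half_relation f g s \<kappa>" and "\<not> differ_on_disk k g"
  shows "half_relation f k s \<kappa>"
  using assms by (auto simp: half_relation_def differ_on_disk_def)

section \<open>Algebra of the splitting\<close>

text \<open>
  With \<open>\<zeta> = x + p\<close> the equation of the curve becomes linear in \<open>x\<close>:
  \<open>(2 \<zeta> - \<alpha> - \<beta>) x = \<zeta>\<^sup>2 - \<alpha> \<beta>\<close>. The coefficient of \<open>x\<close> cannot vanish, since otherwise
  \<open>\<zeta>\<^sup>2 = \<alpha> \<beta>\<close> as well, which forces \<open>\<alpha> = \<beta>\<close>.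
\<close>
lemma curve_point_unique:
  fixes x y p r \<alpha> \<beta> :: complex
  assumes "p\<^sup>2 = (x - \<alpha>) * (x - \<beta>)" and "r\<^sup>2 = (y - \<alpha>) * (y - \<beta>)"
    and "x + p = y + r" and "\<alpha> \<noteq> \<beta>"
  shows "x = y"
proof (rule ccontr)
  assume "x \<noteq> y"
  define \<zeta> where "\<zeta> = x + p"
  have p: "p = \<zeta> - x"
    by (simp add: \<zeta>_def)
  have r: "r = \<zeta> - y"
    unfolding \<zeta>_def assms(3) by simp
  have x: "(2 * \<zeta> - \<alpha> - \<beta>) * x = \<zeta>\<^sup>2 - \<alpha> * \<beta>"
    using assms(1) unfolding p by algebra
  have y: "(2 * \<zeta> - \<alpha> - \<beta>) * y = \<zeta>\<^sup>2 - \<alpha> * \<beta>"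
    using assms(2) unfolding r by algebra
  have "(2 * \<zeta> - \<alpha> - \<beta>) * (x - y) = 0"
    using x y by (simp add: right_diff_distrib)
  with \<open>x \<noteq> y\<close> have "2 * \<zeta> - \<alpha> - \<beta> = 0"
    by simp
  moreover from this x have "\<zeta>\<^sup>2 = \<alpha> * \<beta>"
    by simp
  ultimately have "(\<alpha> - \<beta>)\<^sup>2 = 0"
    by algebra
  with \<open>\<alpha> \<noteq> \<beta>\<close> show False
    by simp
qed

text \<open>
  With \<open>u = \<alpha> / \<beta>\<close> on the unit circle, \<open>c\<^sup>2 = (2 + u + 1 / u) / 4 = (1 + Re u) / 2\<close>,
  which lies in \<open>[0, 1)\<close> because \<open>u \<noteq> 1\<close>.
\<close>
lemma slope_real:
  fixes \<alpha> \<beta> s c :: complex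
  assumes "\<alpha> \<noteq> \<beta>" and "cmod \<alpha> = cmod \<beta>" and "\<alpha> \<noteq> 0"
    and s: "s\<^sup>2 = \<alpha> * \<beta>" and c: "2 * s * c = - (\<alpha> + \<beta>)"
  obtains t :: real where "c = complex_of_real t" and "\<bar>t\<bar> < 1"
proof -
  define u where "u = \<alpha> / \<beta>"
  have "\<beta> \<noteq> 0"
    using assms by auto
  have \<alpha>: "\<alpha> = u * \<beta>"
    using \<open>\<beta> \<noteq> 0\<close> by (simp add: u_def)
  have "cmod u = 1"
    using assms \<open>\<beta> \<noteq> 0\<close> by (simp add: u_def norm_divide)
  have u_cnj: "u * cnj u = 1"
    using \<open>cmod u = 1\<close> by (simp add: complex_norm_square [symmetric])
  have "u \<noteq> 1" and "u \<noteq> 0"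
    using assms \<alpha> by auto
  have "Re u < 1"
  proof -
    have "(Re u)\<^sup>2 + (Im u)\<^sup>2 = 1"
      using \<open>cmod u = 1\<close> by (simp add: cmod_def)
    moreover have "Re u \<le> 1"
      using complex_Re_le_cmod [of u] \<open>cmod u = 1\<close> by simp
    ultimately show ?thesis
      using \<open>u \<noteq> 1\<close> by (cases "Re u = 1") (auto simp: complex_eq_iff)
  qed
  have "- 1 \<le> Re u"
    using abs_Re_le_cmod [of u] \<open>cmod u = 1\<close> by simp
  define m where "m = (1 + Re u) / 2"
  have m: "0 \<le> m" "m < 1"
    using \<open>Re u < 1\<close> \<open>- 1 \<le> Re u\<close> by (simp_all add: m_def)
  have "(2 * s * c)\<^sup>2 = (\<alpha> + \<beta>)\<^sup>2"
    unfolding c by (rule power2_minus)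
  then have "4 * (u * \<beta> * \<beta>) * c\<^sup>2 = (u * \<beta> + \<beta>)\<^sup>2"
    using s unfolding \<alpha> by (simp add: power_mult_distrib)
  then have "\<beta>\<^sup>2 * (4 * u * c\<^sup>2) = \<beta>\<^sup>2 * (u + 1)\<^sup>2"
    by algebra
  then have "4 * u * c\<^sup>2 = (u + 1)\<^sup>2"
    using \<open>\<beta> \<noteq> 0\<close> by simp
  also have "\<dots> = u * (2 + (u + cnj u))"
    using u_cnj by algebra
  finally have "u * (4 * c\<^sup>2) = u * (2 + (u + cnj u))"
    by algebra
  then have "4 * c\<^sup>2 = 2 + (u + cnj u)"
    using \<open>u \<noteq> 0\<close> mult_left_cancel by blast
  also have "\<dots> = 4 * complex_of_real m"
    by (simp add: m_def complex_add_cnj)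
  finally have "c\<^sup>2 = (complex_of_real (sqrt m))\<^sup>2"
    using m by (simp flip: of_real_power)
  then have "c = complex_of_real (sqrt m) \<or> c = complex_of_real (- sqrt m)"
    by (simp add: power2_eq_iff)
  moreover have "\<bar>sqrt m\<bar> < 1" and "\<bar>- sqrt m\<bar> < 1"
    using m by simp_all
  ultimately show thesis
    using that by blast
qed

text \<open>
  The relation can be written \<open>2 (s + g) (f - g) = (\<kappa> - 2) g\<^sup>2\<close>, and the right-hand side vanishes
  only at the origin. Dividing two such equations shows that \<open>(\<kappa> - 2) / (s + g)\<close> is determined;
  as \<open>g\<close> is not constant, so are \<open>\<kappa>\<close> and \<open>s\<close>.
\<close>
lemma relation_determines_base:
  assumes g: "g \<in> class_S"
    and rel: "half_relation f g s \<kappa>" and rel': "half_relation f g s' \<kappa>'"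
    and "\<kappa> \<noteq> 2"
  shows "s = s'"
proof -
  have inj: "inj_on g unit_disk" and "g 0 = 0"
    using g by (auto simp: class_S_def)
  have cross: "(\<kappa> - 2) * (s' + g z) = (\<kappa>' - 2) * (s + g z)" if "z \<in> unit_disk" "z \<noteq> 0" for z
  proof -
    have "g z \<noteq> 0"
      using inj_onD [OF inj, of z 0] that \<open>g 0 = 0\<close> by auto
    have 1: "2 * (s + g z) * (f z - g z) = (\<kappa> - 2) * (g z)\<^sup>2"
      using bspec [OF rel [unfolded half_relation_def] that(1)]
      by (simp add: power2_eq_square algebra_simps)
    have 2: "2 * (s' + g z) * (f z - g z) = (\<kappa>' - 2) * (g z)\<^sup>2"
      using bspec [OF rel' [unfolded half_relation_def] that(1)]
      by (simp add: power2_eq_square algebra_simps)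
    have "(\<kappa> - 2) * (g z)\<^sup>2 \<noteq> 0"
      using \<open>\<kappa> \<noteq> 2\<close> \<open>g z \<noteq> 0\<close> by simp
    then have "f z - g z \<noteq> 0"
      using 1 by auto
    have "(g z)\<^sup>2 * (f z - g z) * ((\<kappa> - 2) * (s' + g z)) =
          (g z)\<^sup>2 * (f z - g z) * ((\<kappa>' - 2) * (s + g z))"
      using 1 2 by algebra
    with \<open>g z \<noteq> 0\<close> \<open>f z - g z \<noteq> 0\<close> show ?thesis
      by simp
  qed
  have mem: "1/2 \<in> unit_disk" "1/3 \<in> unit_disk"
    by (simp_all add: norm_divide)
  have "g (1/2) \<noteq> g (1/3)"
    using inj_onD [OF inj _ mem] by auto
  have "(\<kappa> - \<kappa>') * (g (1/2) - g (1/3)) = 0"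
    using cross [OF mem(1)] cross [OF mem(2)] by simp algebra
  with \<open>g (1/2) \<noteq> g (1/3)\<close> have "\<kappa>' = \<kappa>"
    by simp
  then show ?thesis
    using cross [OF mem(1)] \<open>\<kappa> \<noteq> 2\<close> by simp
qed

section \<open>Splitting a single function\<close>

text \<open>
  The half \<open>f + q\<close>. The other half is the instance with \<open>- q\<close> for \<open>q\<close>. The omitted open set is the
  image of the other half under the affine map that normalises this one.
\<close>
lemma normalised_half:
  fixes f q :: "complex \<Rightarrow> complex"
  assumes f: "f \<in> class_S" and "omits_value f \<alpha>" "omits_value f \<beta>" and "\<alpha> \<noteq> \<beta>"
    and q_hol: "q holomorphic_on unit_disk"
    and q_sq: "\<And>z. z \<in> unit_disk \<Longrightarrow> (q z)\<^sup>2 = (f z - \<alpha>) * (f z - \<beta>)"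
    and c: "(q has_field_derivative c) (at 0)" and sc: "2 * q 0 * c = - (\<alpha> + \<beta>)"
    and \<kappa>: "1 + c \<noteq> 0"
  defines "g \<equiv> \<lambda>z. (f z + q z - q 0) / (1 + c)"
  shows "g \<in> class_S_omitting_open" and "half_relation f g (q 0) (1 + c)"
proof -
  have f_hol: "f holomorphic_on unit_disk" and f0: "f 0 = 0" and f_deriv: "deriv f 0 = 1"
    and f_inj: "inj_on f unit_disk"
    using f by (auto simp: class_S_def)
  have q_nz: "q z \<noteq> 0" if "z \<in> unit_disk" for z
    using q_sq [OF that] assms(2,3) that by (auto simp: omits_value_def)
  \<comment> \<open>The signs cover injectivity of both halves and the disjointness of their images at once.\<close>
  have unique: "z = w" if "z \<in> unit_disk" "w \<in> unit_disk" "f z + \<epsilon> * q z = f w + \<delta> * q w"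
    and "\<epsilon>\<^sup>2 = 1" "\<delta>\<^sup>2 = 1" for z w \<epsilon> \<delta>
  proof -
    have "f z = f w"
      using curve_point_unique [of "\<epsilon> * q z" "f z" \<alpha> \<beta> "\<delta> * q w" "f w"] that q_sq \<open>\<alpha> \<noteq> \<beta>\<close>
      by (simp add: power_mult_distrib)
    then show ?thesis
      using f_inj that by (auto dest: inj_onD)
  qed
  have g_hol: "g holomorphic_on unit_disk"
    unfolding g_def by (intro holomorphic_intros f_hol q_hol \<kappa>)
  have g_inj: "inj_on g unit_disk"
    using unique [of _ _ 1 1] \<kappa> by (auto simp: inj_on_def g_def)
  have "(f has_field_derivative 1) (at 0)"
    using holomorphic_derivI [OF f_hol] f_deriv by (metis centre_in_ball open_ball zero_less_one)
  then have "(g has_field_derivative (1 + c - 0) / (1 + c)) (at 0)"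
    unfolding g_def by (intro DERIV_cdivide DERIV_diff DERIV_add c DERIV_const)
  then have "deriv g 0 = 1"
    using \<kappa> by (simp add: DERIV_imp_deriv)
  with g_hol g_inj have g_S: "g \<in> class_S"
    by (simp add: class_S_def) (simp add: g_def f0)

  define h where "h = (\<lambda>z. (f z - q z - q 0) / (1 + c))"
  have "h holomorphic_on unit_disk"
    unfolding h_def by (intro holomorphic_intros f_hol q_hol \<kappa>)
  moreover have "inj_on h unit_disk"
    using unique [of _ _ "-1" "-1"] \<kappa> by (auto simp: inj_on_def h_def)
  ultimately have "open (h ` unit_disk)"
    by (intro open_mapping_thm3) auto
  moreover have "omits_set g (h ` unit_disk)"
  proof -
    have "h w \<noteq> g z" if "z \<in> unit_disk" "w \<in> unit_disk" for z w
    proof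
      assume "h w = g z"
      then have eq: "f z + q z = f w - q w"
        using \<kappa> by (simp add: g_def h_def)
      then have "z = w"
        using unique [of z w 1 "-1"] that by simp
      with eq q_nz [OF that(1)] show False
        by simp
    qed
    then show ?thesis
      by (fastforce simp: omits_set_def)
  qed
  ultimately show "g \<in> class_S_omitting_open"
    using g_S by (auto simp: class_S_omitting_open_def intro!: exI [of _ "h ` unit_disk"])

  show "half_relation f g (q 0) (1 + c)"
    unfolding half_relation_def
  proof
    fix z :: complex
    assume z: "z \<in> unit_disk"
    have "(q 0)\<^sup>2 = \<alpha> * \<beta>"
      using q_sq [of 0] f0 by simp
    moreover have "q z = (1 + c) * g z - f z + q 0"
      using \<kappa> by (simp add: g_def)
    ultimately have "(1 + c) * (2 * (q 0 + g z) * f z) =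
        (1 + c) * (g z * ((1 + c) * g z + 2 * q 0))"
      using q_sq [OF z] sc by algebra
    then show "2 * (q 0 + g z) * f z = g z * ((1 + c) * g z + 2 * q 0)"
      using \<kappa> by simp
  qed
qed

text \<open>
  The relations are recorded in the conclusion because they identify \<open>\<alpha> \<beta> = s\<^sup>2\<close> from the halves.
\<close>
lemma split_at_omitted_pair:
  assumes f: "f \<in> class_S" and \<alpha>: "omits_value f \<alpha>" and \<beta>: "omits_value f \<beta>"
    and "\<alpha> \<noteq> \<beta>" and "cmod \<alpha> = cmod \<beta>"
  obtains g h s \<kappa> l where
    "g \<in> class_S_omitting_open" "h \<in> class_S_omitting_open" "differ_on_disk g h"
    "s\<^sup>2 = \<alpha> * \<beta>" "half_relation f g s \<kappa>" "half_relation f h (- s) (2 - \<kappa>)" "\<kappa> \<noteq> 2" "\<kappa> \<noteq> 0"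
    "0 < l" "l < 1"
    "\<forall>z\<in>unit_disk. f z = complex_of_real l * g z + complex_of_real (1 - l) * h z"
proof -
  have f_hol: "f holomorphic_on unit_disk" and f0: "f 0 = 0" and f_deriv: "deriv f 0 = 1"
    using f by (auto simp: class_S_def)
  have "\<alpha> \<noteq> 0" "\<beta> \<noteq> 0"
    using \<alpha> \<beta> f0 by (force simp: omits_value_def)+
  have hol: "(\<lambda>z. (f z - \<alpha>) * (f z - \<beta>)) holomorphic_on unit_disk"
    by (intro holomorphic_intros f_hol)
  have nonzero: "(f z - \<alpha>) * (f z - \<beta>) \<noteq> 0" if "z \<in> unit_disk" for z
    using \<alpha> \<beta> that by (auto simp: omits_value_def)
  obtain q where q_hol: "q holomorphic_on unit_disk"
    and q_sq: "\<And>z. z \<in> unit_disk \<Longrightarrow> (f z - \<alpha>) * (f z - \<beta>) = (q z)\<^sup>2"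
    by (rule simply_connected_imp_holomorphic_sqrt [OF hol
          convex_imp_simply_connected [OF convex_ball]
          open_imp_locally_path_connected [OF open_ball] nonzero]) auto
  define c where "c = deriv q 0"
  have q_deriv: "(q has_field_derivative c) (at 0)"
    unfolding c_def using holomorphic_derivI [OF q_hol]
    by (metis centre_in_ball open_ball zero_less_one)
  have "(f has_field_derivative 1) (at 0)"
    using holomorphic_derivI [OF f_hol] f_deriv by (metis centre_in_ball open_ball zero_less_one)
  then have "((\<lambda>z. (f z - \<alpha>) * (f z - \<beta>)) has_field_derivative - (\<alpha> + \<beta>)) (at 0)"
    by (auto intro!: derivative_eq_intros simp: f0)
  then have "((\<lambda>z. (q z)\<^sup>2) has_field_derivative - (\<alpha> + \<beta>)) (at 0)"
    by (rule has_field_derivative_transform_within [where d = 1]) (auto simp: q_sq)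
  moreover have "((\<lambda>z. (q z)\<^sup>2) has_field_derivative 2 * q 0 * c) (at 0)"
    by (auto intro!: derivative_eq_intros q_deriv)
  ultimately have sc: "2 * q 0 * c = - (\<alpha> + \<beta>)"
    using DERIV_unique by blast
  have s_sq: "(q 0)\<^sup>2 = \<alpha> * \<beta>"
    using q_sq [of 0] f0 by simp
  obtain t where t: "c = complex_of_real t" "\<bar>t\<bar> < 1"
    using slope_real [OF \<open>\<alpha> \<noteq> \<beta>\<close> \<open>cmod \<alpha> = cmod \<beta>\<close> \<open>\<alpha> \<noteq> 0\<close> s_sq sc] by blast
  have c1: "1 + c \<noteq> 0" "1 - c \<noteq> 0"
    using t by (auto simp: complex_eq_iff)
  define g where "g = (\<lambda>z. (f z + q z - q 0) / (1 + c))"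
  define h where "h = (\<lambda>z. (f z - q z + q 0) / (1 - c))"
  have g: "g \<in> class_S_omitting_open" "half_relation f g (q 0) (1 + c)"
    using normalised_half [OF f \<alpha> \<beta> \<open>\<alpha> \<noteq> \<beta>\<close> q_hol q_sq [symmetric] q_deriv sc c1(1)]
    by (simp_all add: g_def)
  have h: "h \<in> class_S_omitting_open" "half_relation f h (- q 0) (1 - c)"
    using normalised_half [OF f \<alpha> \<beta> \<open>\<alpha> \<noteq> \<beta>\<close>, of "\<lambda>z. - q z" "- c"]
      q_hol q_sq q_deriv sc c1(2)
    by (simp_all add: h_def holomorphic_on_minus DERIV_minus)
  have eq: "f z = complex_of_real ((1 + t) / 2) * g z + complex_of_real (1 - (1 + t) / 2) * h z" for z
  proof -
    have "(1 + c) * g z = f z + q z - q 0" "(1 - c) * h z = f z - q z + q 0"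
      using c1 by (simp_all add: g_def h_def)
    then have "(1 + c) * g z + (1 - c) * h z = 2 * f z"
      by simp
    then have "f z = ((1 + c) * g z + (1 - c) * h z) / 2"
      by simp
    moreover have "1 - (1 + t) / 2 = (1 - t) / 2"
      by (simp add: field_simps)
    ultimately show ?thesis
      by (simp add: t add_divide_distrib diff_divide_distrib algebra_simps)
  qed
  have "q 0 \<noteq> 0" "1 + c \<noteq> 2"
    using s_sq c1 \<open>\<alpha> \<noteq> 0\<close> \<open>\<beta> \<noteq> 0\<close> by auto
  have "differ_on_disk g h"
  proof (rule ccontr)
    assume "\<not> differ_on_disk g h"
    then have "half_relation f g (- q 0) (1 - c)"
      using half_relation_cong [OF h(2)] by blast
    moreover have "g \<in> class_S"
      using g(1) by (simp add: class_S_omitting_open_def)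
    ultimately have "q 0 = - q 0"
      using relation_determines_base [OF _ g(2) _ \<open>1 + c \<noteq> 2\<close>] by blast
    with \<open>q 0 \<noteq> 0\<close> show False
      by simp
  qed
  moreover have "half_relation f h (- q 0) (2 - (1 + c))"
    using h(2) by simp
  moreover have "0 < (1 + t) / 2" "(1 + t) / 2 < 1"
    using t by auto
  ultimately show thesis
    using that g h(1) s_sq \<open>q 0 \<noteq> 0\<close> \<open>1 + c \<noteq> 2\<close> c1(1) eq by blast
qed

section \<open>Avoiding finitely many functions\<close>

lemma infinite_circle_Int_open:
  fixes a :: complex
  assumes "open V" and "a \<in> V" and "a \<noteq> 0"
  shows "infinite {b \<in> V. cmod b = cmod a \<and> b \<noteq> a}"
proof -
  have "isCont (\<lambda>t. a * cis t) 0"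
    unfolding cis_conv_exp by (intro continuous_intros)
  then have "((\<lambda>t. a * cis t) \<longlongrightarrow> a) (at 0)"
    by (simp add: isCont_def)
  then have "eventually (\<lambda>t. a * cis t \<in> V) (at 0)"
    using assms topological_tendstoD by blast
  then obtain d :: real where "d > 0" and d: "\<And>t. t \<noteq> 0 \<Longrightarrow> \<bar>t\<bar> < d \<Longrightarrow> a * cis t \<in> V"
    by (auto simp: eventually_at dist_real_def)
  \<comment> \<open>The bound by 1 keeps the angles where \<open>sin\<close>, and hence \<open>cis\<close>, is injective.\<close>
  define e where "e = min d 1"
  have "e > 0"
    using \<open>d > 0\<close> by (simp add: e_def)
  have inj: "inj_on (\<lambda>t. a * cis t) {0..<e}"
  proof (rule inj_onI)
    fix t u
    assume tu: "t \<in> {0..<e}" "u \<in> {0..<e}" and "a * cis t = a * cis u"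
    then have "cis t = cis u"
      using \<open>a \<noteq> 0\<close> by simp
    then have "sin t = sin u"
      by (simp add: complex_eq_iff)
    then show "t = u"
      using tu pi_gt3 by (auto simp: e_def intro: sin_inj_pi)
  qed
  have "infinite ((\<lambda>t. a * cis t) ` {0<..<e})"
  proof
    assume "finite ((\<lambda>t. a * cis t) ` {0<..<e})"
    then have "finite {0<..<e}"
      by (rule finite_imageD) (rule inj_on_subset [OF inj], auto)
    then show False
      using \<open>e > 0\<close> infinite_Ioo by blast
  qed
  moreover have "(\<lambda>t. a * cis t) ` {0<..<e} \<subseteq> {b \<in> V. cmod b = cmod a \<and> b \<noteq> a}"
  proof
    fix b
    assume "b \<in> (\<lambda>t. a * cis t) ` {0<..<e}"
    then obtain t where t: "0 < t" "t < e" and b: "b = a * cis t"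
      by auto
    have "b \<noteq> a"
      using inj_onD [OF inj, of t 0] t b \<open>e > 0\<close> by auto
    then show "b \<in> {b \<in> V. cmod b = cmod a \<and> b \<noteq> a}"
      using d [of t] t b by (auto simp: e_def norm_mult)
  qed
  ultimately show ?thesis
    using finite_subset by blast
qed

text \<open>
  Keep one omitted value \<open>a\<close> fixed and let the other one, \<open>b\<close>, run through the infinitely many
  omitted values of the same modulus. If every splitting hit \<open>F\<close>, then by the pigeonhole
  principle one member of \<open>F\<close> would be a half for two different \<open>b\<close>, although it determines
  \<open>s\<close> and therefore \<open>a b\<close>.
\<close>
lemma split_avoiding:
  assumes f: "f \<in> class_S_omitting_open" and "finite F"
  obtains g h l where
    "g \<in> class_S_omitting_open" "h \<in> class_S_omitting_open" "differ_on_disk g h"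
    "\<And>k. k \<in> F \<Longrightarrow> differ_on_disk k g" "\<And>k. k \<in> F \<Longrightarrow> differ_on_disk k h"
    "0 < l" "l < 1"
    "\<And>z. z \<in> unit_disk \<Longrightarrow> f z = complex_of_real l * g z + complex_of_real (1 - l) * h z"
proof (rule ccontr)
  assume not_thesis: "\<not> thesis"
  note avoiding = that
  obtain V where V: "open V" "V \<noteq> {}" "omits_set f V" and fS: "f \<in> class_S"
    using f by (auto simp: class_S_omitting_open_def)
  obtain a where a: "a \<in> V"
    using V by auto
  have omits: "omits_value f b" if "b \<in> V" for b
    using V that by (auto simp: omits_set_def omits_value_def)
  have "a \<noteq> 0"
    using omits [OF a] fS by (force simp: omits_value_def class_S_def)
  define T where "T = {b \<in> V. cmod b = cmod a \<and> b \<noteq> a}"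
  have "infinite T"
    using infinite_circle_Int_open [OF V(1) a \<open>a \<noteq> 0\<close>] by (simp add: T_def)
  \<comment> \<open>The functions in \<open>F\<close> are compared on the disk only, hence the witness \<open>g\<close> in \<open>S\<close>.\<close>
  define hit where "hit b k \<longleftrightarrow> (\<exists>g \<sigma> \<kappa>. g \<in> class_S \<and> \<not> differ_on_disk k g \<and>
    half_relation f g \<sigma> \<kappa> \<and> \<sigma>\<^sup>2 = a * b \<and> \<kappa> \<noteq> 2)" for b k
  have "\<exists>k\<in>F. hit b k" if b: "b \<in> T" for b
  proof -
    have bT: "b \<in> V" "cmod a = cmod b" "a \<noteq> b"
      using b by (auto simp: T_def)
    obtain g h s \<kappa> l where
      members: "g \<in> class_S_omitting_open" "h \<in> class_S_omitting_open"
      and differ: "differ_on_disk g h" and s: "s\<^sup>2 = a * b"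
      and rel: "half_relation f g s \<kappa>" "half_relation f h (- s) (2 - \<kappa>)"
      and \<kappa>: "\<kappa> \<noteq> 2" "\<kappa> \<noteq> 0"
      and split: "0 < l" "l < 1"
      "\<forall>z\<in>unit_disk. f z = complex_of_real l * g z + complex_of_real (1 - l) * h z"
      by (rule split_at_omitted_pair [OF fS omits [OF a] omits [OF bT(1)] bT(3,2)])
    have gh: "g \<in> class_S" "h \<in> class_S"
      using members by (auto simp: class_S_omitting_open_def)
    have "\<exists>k\<in>F. \<not> differ_on_disk k g \<or> \<not> differ_on_disk k h"
    proof (rule ccontr)
      assume *: "\<not> ?thesis"
      have thesis
        by (rule avoiding [OF members differ _ _ split(1,2)])
          (use * split(3) in auto)
      with not_thesis show False ..
    qed
    then obtain k where k: "k \<in> F" "\<not> differ_on_disk k g \<or> \<not> differ_on_disk k h"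
      by blast
    from k(2) have "hit b k"
    proof
      assume "\<not> differ_on_disk k g"
      then show ?thesis
        using gh rel s \<kappa> unfolding hit_def by blast
    next
      assume "\<not> differ_on_disk k h"
      moreover have "(- s)\<^sup>2 = a * b" "2 - \<kappa> \<noteq> 2"
        using s \<kappa> by auto
      ultimately show ?thesis
        using gh rel unfolding hit_def by blast
    qed
    with k show ?thesis
      by blast
  qed
  then obtain \<phi> where \<phi>: "\<And>b. b \<in> T \<Longrightarrow> \<phi> b \<in> F \<and> hit b (\<phi> b)"
    by metis
  have "inj_on \<phi> T"
  proof (rule inj_onI)
    fix b b'
    assume b: "b \<in> T" "b' \<in> T" and same: "\<phi> b = \<phi> b'"
    obtain g \<sigma> \<kappa> where g: "g \<in> class_S" "\<not> differ_on_disk (\<phi> b) g"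
      "half_relation f g \<sigma> \<kappa>" "\<sigma>\<^sup>2 = a * b" "\<kappa> \<noteq> 2"
      using \<phi> b unfolding hit_def by metis
    obtain g' \<sigma>' \<kappa>' where g': "\<not> differ_on_disk (\<phi> b) g'"
      "half_relation f g' \<sigma>' \<kappa>'" "\<sigma>'\<^sup>2 = a * b'"
      using \<phi> b same unfolding hit_def by metis
    have "\<not> differ_on_disk g g'"
      using g(2) g'(1) by (auto simp: differ_on_disk_def)
    then have "half_relation f g \<sigma>' \<kappa>'"
      using half_relation_cong g'(2) by blast
    then have "\<sigma> = \<sigma>'"
      using relation_determines_base g by blast
    then have "a * b = a * b'"
      using g(4) g'(3) by metis
    then show "b = b'"
      using \<open>a \<noteq> 0\<close> by simp
  qed
  moreover have "finite (\<phi> ` T)"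
    using \<phi> \<open>finite F\<close> finite_subset by (metis image_subsetI)
  ultimately show False
    using \<open>infinite T\<close> finite_imageD by blast
qed

section \<open>Doubling the number of summands\<close>

text \<open>
  The members of \<open>A\<close> are split one after the other, each time avoiding the halves produced so far.
\<close>
lemma double_summands:
  fixes w :: "(complex \<Rightarrow> complex) \<Rightarrow> real"
  assumes "finite A" and "A \<subseteq> class_S_omitting_open" and "\<And>g. g \<in> A \<Longrightarrow> 0 < w g"
  shows "\<exists>B v. finite B \<and> card B = 2 * card A \<and> B \<subseteq> class_S_omitting_open \<and>
    pairwise differ_on_disk B \<and> (\<forall>g\<in>B. 0 < v g) \<and> sum v B = sum w A \<and>
    (\<forall>z\<in>unit_disk. (\<Sum>g\<in>A. complex_of_real (w g) * g z) = (\<Sum>g\<in>B. complex_of_real (v g) * g z))"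
  using assms
proof (induction A)
  case empty
  show ?case
    by (intro exI [of _ "{}"]) auto
next
  case (insert f A)
  then have A: "A \<subseteq> class_S_omitting_open" "\<And>g. g \<in> A \<Longrightarrow> 0 < w g"
    by auto
  then obtain B and v :: "(complex \<Rightarrow> complex) \<Rightarrow> real" where
    B: "finite B" "card B = 2 * card A" "B \<subseteq> class_S_omitting_open" "pairwise differ_on_disk B"
    "\<And>g. g \<in> B \<Longrightarrow> 0 < v g" "sum v B = sum w A"
    and B_sum: "\<And>z. z \<in> unit_disk \<Longrightarrow>
      (\<Sum>g\<in>A. complex_of_real (w g) * g z) = (\<Sum>g\<in>B. complex_of_real (v g) * g z)"
    using insert.IH [OF A] by blast
  have "f \<in> class_S_omitting_open" "0 < w f"
    using insert.prems by auto
  obtain g h l where gh: "g \<in> class_S_omitting_open" "h \<in> class_S_omitting_open"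
    and differ: "differ_on_disk g h"
      "\<And>k. k \<in> B \<Longrightarrow> differ_on_disk k g" "\<And>k. k \<in> B \<Longrightarrow> differ_on_disk k h"
    and l: "0 < l" "l < 1"
    and f_eq: "\<And>z. z \<in> unit_disk \<Longrightarrow>
      f z = complex_of_real l * g z + complex_of_real (1 - l) * h z"
    using split_avoiding [OF \<open>f \<in> class_S_omitting_open\<close> \<open>finite B\<close>] by blast
  have new: "g \<notin> B" "h \<notin> B" "g \<noteq> h"
    using differ by (auto simp: differ_on_disk_def)
  define v' where "v' = v(g := w f * l, h := w f * (1 - l))"
  have v': "v' g = w f * l" "v' h = w f * (1 - l)" and v'_old: "\<And>k. k \<in> B \<Longrightarrow> v' k = v k"
    using new by (auto simp: v'_def)
  show ?case
  proof (intro exI [of _ "insert g (insert h B)"] exI [of _ v'] conjI ballI)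
    show "card (insert g (insert h B)) = 2 * card (insert f A)"
      using B new insert.hyps by simp
    show "pairwise differ_on_disk (insert g (insert h B))"
      using B differ differ_on_disk_commute by (auto simp: pairwise_insert)
    show "0 < v' k" if "k \<in> insert g (insert h B)" for k
      using that B l v' v'_old \<open>0 < w f\<close> by auto
    have "sum v' B = sum v B"
      using v'_old by simp
    then show "sum v' (insert g (insert h B)) = sum w (insert f A)"
      using B new insert.hyps by (simp add: v' algebra_simps)
    fix z :: complex
    assume z: "z \<in> unit_disk"
    have "(\<Sum>k\<in>B. complex_of_real (v' k) * k z) = (\<Sum>k\<in>B. complex_of_real (v k) * k z)"
      using v'_old by simp
    then show "(\<Sum>g\<in>insert f A. complex_of_real (w g) * g z) =
        (\<Sum>k\<in>insert g (insert h B). complex_of_real (v' k) * k z)"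
      using B(1) new insert.hyps B_sum [OF z] by (simp add: v' f_eq [OF z] algebra_simps)
  qed (use B gh in auto)
qed

text \<open>
  Only the first splitting uses the given pair of omitted values: \<open>f\<close> itself need not omit an open
  set, but its two halves do, and from then on the summands can be doubled.
\<close>
lemma convex_combination_pow2:
  assumes f: "f \<in> class_S" and \<alpha>: "omits_value f \<alpha>" and \<beta>: "omits_value f \<beta>"
    and "\<alpha> \<noteq> \<beta>" and "cmod \<alpha> = cmod \<beta>"
  shows "\<exists>B v. finite B \<and> card B = 2 ^ Suc m \<and> B \<subseteq> class_S_omitting_open \<and>
    pairwise differ_on_disk B \<and> (\<forall>g\<in>B. 0 < v g) \<and> sum v B = (1 :: real) \<and>
    (\<forall>z\<in>unit_disk. f z = (\<Sum>g\<in>B. complex_of_real (v g) * g z))"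
proof (induction m)
  case 0
  obtain g h s \<kappa> l where
    gh: "g \<in> class_S_omitting_open" "h \<in> class_S_omitting_open"
    and differ: "differ_on_disk g h" and s: "s\<^sup>2 = \<alpha> * \<beta>"
    and rel: "half_relation f g s \<kappa>" "half_relation f h (- s) (2 - \<kappa>)"
    and \<kappa>: "\<kappa> \<noteq> 2" "\<kappa> \<noteq> 0"
    and l: "0 < l" "l < 1"
    and f_eq: "\<forall>z\<in>unit_disk. f z = complex_of_real l * g z + complex_of_real (1 - l) * h z"
    by (rule split_at_omitted_pair [OF assms])
  have "g \<noteq> h"
    using differ by (auto simp: differ_on_disk_def)
  show ?case
  proof (intro exI [of _ "{g, h}"] exI [of _ "\<lambda>k. if k = g then l else 1 - l"] conjI)
    show "pairwise differ_on_disk {g, h}"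
      using differ differ_on_disk_commute by (auto simp: pairwise_insert)
  qed (use gh l f_eq \<open>g \<noteq> h\<close> in auto)
next
  case (Suc m)
  then obtain A and w :: "(complex \<Rightarrow> complex) \<Rightarrow> real" where
    A: "finite A" "card A = 2 ^ Suc m" "A \<subseteq> class_S_omitting_open" "\<And>g. g \<in> A \<Longrightarrow> 0 < w g"
    "sum w A = 1"
    and f_eq: "\<And>z. z \<in> unit_disk \<Longrightarrow> f z = (\<Sum>g\<in>A. complex_of_real (w g) * g z)"
    by blast
  have "2 * card A = 2 ^ Suc (Suc m)"
    by (simp add: A(2))
  with double_summands [where w = w, OF A(1,3,4)] show ?case
    by (simp only: A(5) f_eq cong: ball_cong)
qed

theorem theorem2p1:
  fixes f :: "complex \<Rightarrow> complex" and n :: nat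
  assumes "f \<in> class_S"
    and "\<exists>\<alpha> \<beta>. omits_value f \<alpha> \<and> omits_value f \<beta> \<and> \<alpha> \<noteq> \<beta> \<and> cmod \<alpha> = cmod \<beta>"
    and "n \<ge> 1"
  shows "\<exists>(a :: nat \<Rightarrow> real) (g :: nat \<Rightarrow> complex \<Rightarrow> complex).
    (\<forall>z\<in>unit_disk. f z = (\<Sum>j=1..2^n. complex_of_real (a j) * g j z)) \<and>
    (\<forall>j\<in>{1..2^n}. 0 < a j \<and> a j < 1) \<and>
    (\<Sum>j=1..2^n. a j) = 1 \<and>
    (\<forall>j\<in>{1..2^n}. g j \<in> class_S) \<and>
    (\<forall>i\<in>{1..2^n}. \<forall>j\<in>{1..2^n}. i \<noteq> j \<longrightarrow> (\<exists>z\<in>unit_disk. g i z \<noteq> g j z)) \<and>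
    (\<forall>j\<in>{1..2^n}. \<exists>V. open V \<and> V \<noteq> {} \<and> omits_set (g j) V)"
proof -
  obtain \<alpha> \<beta> where "omits_value f \<alpha>" "omits_value f \<beta>" "\<alpha> \<noteq> \<beta>" "cmod \<alpha> = cmod \<beta>"
    using assms(2) by blast
  moreover obtain m where "n = Suc m"
    using \<open>n \<ge> 1\<close> by (cases n) auto
  ultimately obtain B and v :: "(complex \<Rightarrow> complex) \<Rightarrow> real" where
    B: "finite B" "card B = 2 ^ n" "B \<subseteq> class_S_omitting_open" "pairwise differ_on_disk B"
    "\<And>g. g \<in> B \<Longrightarrow> 0 < v g" "sum v B = 1"
    and f_eq: "\<And>z. z \<in> unit_disk \<Longrightarrow> f z = (\<Sum>g\<in>B. complex_of_real (v g) * g z)"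
    using convex_combination_pow2 [OF assms(1), of \<alpha> \<beta> m] by blast
  have less_1: "v k < 1" if "k \<in> B" for k
  proof -
    have "card (B - {k}) = 2 ^ n - 1"
      using B that by simp
    moreover have "(2 :: nat) ^ 1 \<le> 2 ^ n"
      using \<open>n \<ge> 1\<close> by (intro power_increasing) auto
    ultimately have "B - {k} \<noteq> {}"
      by (intro notI) simp
    then have "0 < sum v (B - {k})"
      using B by (intro sum_pos) auto
    then show ?thesis
      using B that by (simp add: sum_diff1)
  qed
  obtain e where e: "bij_betw e {1..(2 :: nat) ^ n} B"
    using ex_bij_betw_nat_finite_1 [OF B(1)] B(2) by auto
  have e_mem: "e j \<in> B" if "j \<in> {1..2 ^ n}" for j
    using e that by (auto simp: bij_betw_def)
  show ?thesis
  proof (intro exI [of _ "\<lambda>j. v (e j)"] exI [of _ e] conjI ballI impI)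
    fix z :: complex
    assume "z \<in> unit_disk"
    then show "f z = (\<Sum>j = 1..2 ^ n. complex_of_real (v (e j)) * e j z)"
      using f_eq sum.reindex_bij_betw [OF e, of "\<lambda>k. complex_of_real (v k) * k z"] by simp
  next
    show "(\<Sum>j = 1..2 ^ n. v (e j)) = 1"
      using B(6) sum.reindex_bij_betw [OF e, of v] by simp
  next
    fix i j :: nat
    assume ij: "i \<in> {1..2 ^ n}" "j \<in> {1..2 ^ n}" "i \<noteq> j"
    then have "e i \<noteq> e j"
      using e by (auto simp: bij_betw_def inj_on_def)
    then show "\<exists>z\<in>unit_disk. e i z \<noteq> e j z"
      using B(4) e_mem ij by (auto simp: pairwise_def differ_on_disk_def)
  qed (use e_mem B less_1 in \<open>auto simp: class_S_omitting_open_def\<close>)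
qed

end
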